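(* Let $F_1,\dots,F_n:\mathbb{R}^d\to\mathbb{R}$ satisfy, for every $i$: $0\le F_i(w)\le B$ for all $w$, $F_i$ is $G$-Lipschitz, and $F_i$ is continuously differentiable with $L$-Lipschitz gradient. Let $\theta\in(0,1)$, $\lambda\ge0$, and $F_\theta(w)=\max_{\pi\in\mathcal{P}_\theta}\sum_{i=1}^n\pi_iF_i(w)+\frac\lambda2\|w\|^2$. Fix $w\in\mathbb{R}^d$ and let $\pi^\star\in\arg\max_{\pi\in\mathcal{P}_\theta}\sum_{i=1}^n\pi_iF_i(w)$. Then $$\sum_{i=1}^n\pi_i^\star\nabla F_i(w)+\lambda w\in\partial F_\theta(w),$$ where $\partial F_\theta(w)$ denotes the regular (Fréchet) subdifferential of $F_\theta$ at $w$.
   Context: $\mathcal{P}_\theta=\{\pi\in\mathbb{R}^n_+:\ \sum_{i=1}^n\pi_i=1,\ \pi_i\le(n\theta)^{-1}\ \forall i\}$. The regular subdifferential of $\psi:\mathbb{R}^d\to\mathbb{R}$ at $\bar w$ is $\partial\psi(\bar w)=\{s\in\mathbb{R}^d:\ \psi(w)\ge\psi(\bar w)+\langle s,w-\bar w\rangle+o(\|w-\bar w\|)\}$. ($F_\theta$ is the $(1-\theta)$-superquantile of the losses $F_1(w),\dots,F_n(w)$ plus regularization, written in dual form.) *)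

theory Defs
  imports "HOL-Analysis.Analysis" "HOL-Library.Landau_Symbols"
begin

definition capped_simplex :: "real \<Rightarrow> (real ^ 'n::finite) set" where
  "capped_simplex \<theta> = {\<pi>. (\<forall>i. 0 \<le> \<pi> $ i) \<and> (\<Sum>i\<in>UNIV. \<pi> $ i) = 1 \<and>
     (\<forall>i. \<pi> $ i \<le> 1 / (real CARD('n) * \<theta>))}"

(* The supremum is a maximum for 0 < \<theta> < 1: see weighted_loss_max_attained below. *)
definition superquantile_loss ::
  "('n::finite \<Rightarrow> 'a::real_normed_vector \<Rightarrow> real) \<Rightarrow> real \<Rightarrow> real \<Rightarrow> 'a \<Rightarrow> real" where
  "superquantile_loss F \<theta> lam w =
     (SUP \<pi>\<in>capped_simplex \<theta>. \<Sum>i\<in>UNIV. \<pi> $ i * F i w) + lam / 2 * (norm w)\<^sup>2"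

definition regular_subdifferential ::
  "('a::real_inner \<Rightarrow> real) \<Rightarrow> 'a \<Rightarrow> 'a set" where
  "regular_subdifferential \<psi> w0 = {s. \<exists>r. r \<in> o[at w0](\<lambda>w. norm (w - w0)) \<and>
     (\<forall>w. \<psi> w \<ge> \<psi> w0 + s \<bullet> (w - w0) + r w)}"

lemma compact_capped_simplex: "compact (capped_simplex \<theta> :: (real ^ 'n::finite) set)"
proof -
  let ?S = "capped_simplex \<theta> :: (real ^ 'n) set"
  have "?S = {0 .. (\<chi> i. 1 / (real CARD('n) * \<theta>))} \<inter> {\<pi>. (\<Sum>i\<in>UNIV. \<pi> $ i) = 1}"
    by (auto simp: capped_simplex_def less_eq_vec_def)
  moreover have "closed {\<pi> :: real ^ 'n. (\<Sum>i\<in>UNIV. \<pi> $ i) = 1}"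
    by (intro closed_Collect_eq continuous_intros)
  moreover have "compact {0 .. (\<chi> i. 1 / (real CARD('n) * \<theta>)) :: real ^ 'n}"
    by (simp flip: interval_cbox)
  ultimately show ?thesis
    by (simp add: compact_Int_closed)
qed

lemma capped_simplex_nonempty:
  assumes "0 < \<theta>" "\<theta> < 1"
  shows "(capped_simplex \<theta> :: (real ^ 'n::finite) set) \<noteq> {}"
proof -
  have "(\<chi> i. 1 / real CARD('n)) \<in> (capped_simplex \<theta> :: (real ^ 'n) set)"
    using assms by (auto simp: capped_simplex_def field_simps)
  then show ?thesis by blast
qed

lemma weighted_loss_max_attained:
  fixes F :: "'n::finite \<Rightarrow> 'a \<Rightarrow> real"
  assumes "0 < \<theta>" "\<theta> < 1"
  obtains \<pi> where "\<pi> \<in> capped_simplex \<theta>"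
    and "\<And>\<rho>. \<rho> \<in> capped_simplex \<theta> \<Longrightarrow>
           (\<Sum>i\<in>UNIV. \<rho> $ i * F i w) \<le> (\<Sum>i\<in>UNIV. \<pi> $ i * F i w)"
    and "(SUP \<rho>\<in>capped_simplex \<theta>. \<Sum>i\<in>UNIV. \<rho> $ i * F i w) = (\<Sum>i\<in>UNIV. \<pi> $ i * F i w)"
proof -
  have "continuous_on (capped_simplex \<theta>) (\<lambda>\<rho> :: real ^ 'n. \<Sum>i\<in>UNIV. \<rho> $ i * F i w)"
    by (intro continuous_intros)
  then obtain \<pi> :: "real ^ 'n" where *: "\<pi> \<in> capped_simplex \<theta>"
    "\<forall>\<rho>\<in>capped_simplex \<theta>. (\<Sum>i\<in>UNIV. \<rho> $ i * F i w) \<le> (\<Sum>i\<in>UNIV. \<pi> $ i * F i w)"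
    using continuous_attains_sup[OF compact_capped_simplex capped_simplex_nonempty[OF assms]]
    by blast
  show ?thesis
  proof (rule that)
    show "(SUP \<rho>\<in>capped_simplex \<theta>. \<Sum>i\<in>UNIV. \<rho> $ i * F i w) = (\<Sum>i\<in>UNIV. \<pi> $ i * F i w)"
      using * by (intro cSup_eq_maximum) auto
  qed (use * in auto)
qed

end

(* At w, the smooth function obtained by freezing the weights at \<pi>\<^sup>\<star> touches F_\<theta> from below, so its
   gradient there is a regular subgradient of F_\<theta>. *)
theory Submission
  imports Defs
begin

text \<open>Danskin-type argument: with the weights held at a maximizer for \<open>w\<close>, the
  weighted loss plus regularizer is a differentiable minorant of the superquantile loss
  (\<open>superquantile_loss_ge\<close>) that touches it at \<open>w\<close>
  (\<open>superquantile_loss_eq_arg_max\<close>). Its gradient is the claimed vector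
  (\<open>gderiv_weighted_loss\<close>), and the gradient of a touching minorant is a regular
  subgradient.\<close>

lemma gderiv_remainder_smallo:
  fixes f :: "'a::real_inner \<Rightarrow> real"
  assumes "GDERIV f x :> D"
  shows "(\<lambda>y. f y - f x - D \<bullet> (y - x)) \<in> o[at x](\<lambda>y. norm (y - x))"
proof (rule smalloI_tendsto)
  have "((\<lambda>y. (1 / norm (y - x)) *\<^sub>R (f y - (f x + (y - x) \<bullet> D))) \<longlongrightarrow> 0) (at x)"
    using assms unfolding gderiv_def has_derivative_within by blast
  then show "((\<lambda>y. (f y - f x - D \<bullet> (y - x)) / norm (y - x)) \<longlongrightarrow> 0) (at x)"
    by (simp add: inner_commute diff_diff_eq)
  \<comment> \<open>The quotient criterion for little-o needs a nonvanishing denominator;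
    \<open>at x\<close> is punctured at \<open>x\<close>.\<close>
  show "\<forall>\<^sub>F y in at x. norm (y - x) \<noteq> 0"
    by (auto simp: eventually_at_filter)
qed

text \<open>The first-order remainder of \<open>f\<close> itself serves as \<open>r\<close>: since
  \<open>f x = \<psi> x\<close>, the subgradient inequality then collapses to
  \<open>f y \<le> \<psi> y\<close>.\<close>

lemma gradient_of_minorant_in_regular_subdifferential:
  fixes f \<psi> :: "'a::real_inner \<Rightarrow> real"
  assumes "GDERIV f x :> D" "\<And>y. f y \<le> \<psi> y" "f x = \<psi> x"
  shows "D \<in> regular_subdifferential \<psi> x"
  unfolding regular_subdifferential_def
  using assms(2,3) gderiv_remainder_smallo[OF assms(1)]
  by (auto intro!: exI[of _ "\<lambda>y. f y - f x - D \<bullet> (y - x)"])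

text \<open>A real \<open>SUP\<close> dominates its members only when they are bounded above; the
  attained maximum supplies that bound.\<close>

lemma superquantile_loss_ge:
  fixes \<pi> :: "real ^ 'n::finite"
  assumes "0 < \<theta>" "\<theta> < 1" "\<pi> \<in> capped_simplex \<theta>"
  shows "(\<Sum>i\<in>UNIV. \<pi> $ i * F i x) + lam / 2 * (norm x)\<^sup>2 \<le> superquantile_loss F \<theta> lam x"
proof -
  obtain \<rho> :: "real ^ 'n" where
    "\<And>\<sigma>. \<sigma> \<in> capped_simplex \<theta> \<Longrightarrow> (\<Sum>i\<in>UNIV. \<sigma> $ i * F i x) \<le> (\<Sum>i\<in>UNIV. \<rho> $ i * F i x)"
    "(SUP \<sigma>\<in>capped_simplex \<theta>. \<Sum>i\<in>UNIV. \<sigma> $ i * F i x) = (\<Sum>i\<in>UNIV. \<rho> $ i * F i x)"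
    by (rule weighted_loss_max_attained[OF assms(1,2), where F = F and w = x]) blast
  then show ?thesis
    using assms(3) by (simp add: superquantile_loss_def)
qed

text \<open>The given maximizer is feasible and its value bounds all others, so the supremum is
  attained there.\<close>

lemma superquantile_loss_eq_arg_max:
  fixes \<pi> :: "real ^ 'n::finite"
  assumes "is_arg_max (\<lambda>\<pi>. \<Sum>i\<in>UNIV. \<pi> $ i * F i x) (\<lambda>\<pi>. \<pi> \<in> capped_simplex \<theta>) \<pi>"
  shows "superquantile_loss F \<theta> lam x = (\<Sum>i\<in>UNIV. \<pi> $ i * F i x) + lam / 2 * (norm x)\<^sup>2"
proof -
  have "(SUP \<rho>\<in>capped_simplex \<theta>. \<Sum>i\<in>UNIV. \<rho> $ i * F i x) = (\<Sum>i\<in>UNIV. \<pi> $ i * F i x)"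
    using assms by (intro cSup_eq_maximum) (auto simp: is_arg_max_linorder)
  then show ?thesis
    by (simp add: superquantile_loss_def)
qed

lemma gderiv_weighted_loss:
  fixes F :: "'n::finite \<Rightarrow> 'a::real_inner \<Rightarrow> real"
  assumes "\<And>i. GDERIV (F i) x :> D i"
  shows "GDERIV (\<lambda>y. (\<Sum>i\<in>UNIV. c i * F i y) + lam / 2 * (norm y)\<^sup>2) x
           :> (\<Sum>i\<in>UNIV. c i *\<^sub>R D i) + lam *\<^sub>R x"
proof -
  have [derivative_intros]: "(F i has_derivative (\<lambda>h. h \<bullet> D i)) (at x)" for i
    using assms unfolding gderiv_def .
  \<comment> \<open>Writing the squared norm as \<open>y \<bullet> y\<close> allows the product
    rule; by symmetry its two terms agree and cancel the factor 1/2.\<close>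
  have "((\<lambda>y. (\<Sum>i\<in>UNIV. c i * F i y) + lam / 2 * (y \<bullet> y)) has_derivative
          (\<lambda>h. (\<Sum>i\<in>UNIV. c i * (h \<bullet> D i)) + lam / 2 * (x \<bullet> h + h \<bullet> x))) (at x)"
    by (intro derivative_intros)
  then show ?thesis
    by (simp add: gderiv_def power2_norm_eq_inner inner_add_right inner_sum_right inner_commute[of x])
qed

theorem mainTheorem5:
  fixes F :: "'n::finite \<Rightarrow> real ^ 'd::finite \<Rightarrow> real"
    and gradF :: "'n \<Rightarrow> real ^ 'd \<Rightarrow> real ^ 'd"
    and B G L \<theta> lam :: real
    and w :: "real ^ 'd"
    and \<pi>s :: "real ^ 'n"
  assumes bounded: "\<And>i x. 0 \<le> F i x \<and> F i x \<le> B"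
    and lipschitz: "\<And>i. G-lipschitz_on UNIV (F i)"
    and gradient: "\<And>i x. GDERIV (F i) x :> gradF i x"
    and gradient_continuous: "\<And>i. continuous_on UNIV (gradF i)"
    and gradient_lipschitz: "\<And>i. L-lipschitz_on UNIV (gradF i)"
    and theta: "0 < \<theta>" "\<theta> < 1"
    and lam: "0 \<le> lam"
    and argmax: "is_arg_max (\<lambda>\<pi>. \<Sum>i\<in>UNIV. \<pi> $ i * F i w) (\<lambda>\<pi>. \<pi> \<in> capped_simplex \<theta>) \<pi>s"
  shows "(\<Sum>i\<in>UNIV. \<pi>s $ i *\<^sub>R gradF i w) + lam *\<^sub>R w
           \<in> regular_subdifferential (superquantile_loss F \<theta> lam) w"
proof (rule gradient_of_minorant_in_regular_subdifferential)
  show "GDERIV (\<lambda>x. (\<Sum>i\<in>UNIV. \<pi>s $ i * F i x) + lam / 2 * (norm x)\<^sup>2) w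
          :> (\<Sum>i\<in>UNIV. \<pi>s $ i *\<^sub>R gradF i w) + lam *\<^sub>R w"
    using gradient by (rule gderiv_weighted_loss)
  \<comment> \<open>Feasibility does not depend on the point, so weights optimal at \<open>w\<close>
    give a lower bound at every \<open>x\<close>.\<close>
  have "\<pi>s \<in> capped_simplex \<theta>"
    using argmax by (simp add: is_arg_max_def)
  then show "(\<Sum>i\<in>UNIV. \<pi>s $ i * F i x) + lam / 2 * (norm x)\<^sup>2 \<le> superquantile_loss F \<theta> lam x" for x
    by (rule superquantile_loss_ge[OF theta])
  show "(\<Sum>i\<in>UNIV. \<pi>s $ i * F i w) + lam / 2 * (norm w)\<^sup>2 = superquantile_loss F \<theta> lam w"
    by (rule superquantile_loss_eq_arg_max[where F = F, OF argmax, symmetric])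
qed

end
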